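(* Let $n$ be a positive integer and let $P_1, P_2 \subseteq \mathbb{Z}_n$ be Z-related. Then the weighted clique complexes $\Delta(G(P_1))$ and $\Delta(G(P_2))$ are non-isomorphic, and there exists a finite $k \geq 1$ such that the weighted $k$-skeleta $\Delta_k(G(P_1))$ and $\Delta_k(G(P_2))$ are non-isomorphic while the weighted $(k-1)$-skeleta $\Delta_{k-1}(G(P_1))$ and $\Delta_{k-1}(G(P_2))$ have the same simplex-weight multiset.
   Context: Elements of $\mathbb{Z}_n$ are represented by integers in $\{0,\ldots,n-1\}$. The interval class is $\mathrm{ic}(p,q) = \min(|p-q|,\ n-|p-q|)$, computed with these representatives. For $P \subseteq \mathbb{Z}_n$, the pitch class graph $G(P)$ is the complete weighted graph with vertex set $P$ in which each unordered pair $\{p,q\}$ of distinct elements has weight $w(\{p,q\}) = \mathrm{ic}(p,q)$, and $\mu(P)$ is the multiset of all these weights. The dihedral group $D_n$ acts on $\mathbb{Z}_n$ by $T_s(p) = p+s$ and $I_s(p) = s-p$ (mod $n$); two sets are T/I-equivalent if one is the image of the other under some $g \in D_n$. Two sets are Z-related if $\mu(P_1) = \mu(P_2)$ but they are not T/I-equivalent. The weighted clique complex $\Delta(G(P))$ is the simplicial complex whose simplices are the cliques of $G(P)$, each simplex $\sigma \subseteq P$ carrying as its weight the edge-weight multiset $\{w(\{p,q\}) : p,q \in \sigma,\ p \ne q\}$ (one entry per unordered pair). The $k$-skeleton $\Delta_k(G(P))$ consists of all simplices of dimension at most $k-1$, i.e. all cliques of size at most $k$, with their weights. An isomorphism of weighted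 complexes is a bijection of vertices inducing a bijection of simplices that preserves simplex weights. The simplex-weight multiset of a weighted skeleton is the multiset of the weights (edge-weight multisets) of its simplices, taken in each dimension. *)

theory Defs
  imports "HOL-Library.Multiset"
begin

record ('a, 'w) wgraph =
  verts :: "'a set"
  edges :: "'a set set"
  weight :: "'a set \<Rightarrow> 'w"

definition unordered_pairs :: "'a set \<Rightarrow> 'a set set" where
  "unordered_pairs S = {{p, q} | p q. p \<in> S \<and> q \<in> S \<and> p \<noteq> q}"

text \<open>Simplices are nonempty, so a simplex of cardinality \<open>d + 1\<close> has dimension \<open>d\<close>.\<close>

record ('a, 'w) wcomplex =
  simplices :: "'a set set"
  sweight :: "'a set \<Rightarrow> 'w multiset"

definition is_clique :: "('a, 'w) wgraph \<Rightarrow> 'a set \<Rightarrow> bool" where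
  "is_clique G \<sigma> \<longleftrightarrow> \<sigma> \<subseteq> verts G \<and> unordered_pairs \<sigma> \<subseteq> edges G"

definition clique_complex :: "('a, 'w) wgraph \<Rightarrow> ('a, 'w) wcomplex" where
  "clique_complex G =
    \<lparr> simplices = {\<sigma>. finite \<sigma> \<and> \<sigma> \<noteq> {} \<and> is_clique G \<sigma>},
      sweight = (\<lambda>\<sigma>. image_mset (weight G) (mset_set (unordered_pairs \<sigma>))) \<rparr>"

text \<open>Note the index shift: the \<open>k\<close>-skeleton consists of the simplices with at most \<open>k\<close> vertices,
  that is, of dimension at most \<open>k - 1\<close>.\<close>

definition skeleton :: "nat \<Rightarrow> ('a, 'w) wcomplex \<Rightarrow> ('a, 'w) wcomplex" where
  "skeleton k K = \<lparr> simplices = {\<sigma> \<in> simplices K. card \<sigma> \<le> k}, sweight = sweight K \<rparr>"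

definition vertices :: "('a, 'w) wcomplex \<Rightarrow> 'a set" where
  "vertices K = \<Union> (simplices K)"

definition wcomplex_iso :: "('a, 'w) wcomplex \<Rightarrow> ('b, 'w) wcomplex \<Rightarrow> bool" where
  "wcomplex_iso K L \<longleftrightarrow>
    (\<exists>f. bij_betw f (vertices K) (vertices L) \<and>
         bij_betw (image f) (simplices K) (simplices L) \<and>
         (\<forall>\<sigma> \<in> simplices K. sweight L (f ` \<sigma>) = sweight K \<sigma>))"

text \<open>The argument \<open>d\<close> is the dimension, so that equality of the functions \<open>simplex_weights K\<close>
  and \<open>simplex_weights L\<close> compares the multisets of simplex weights dimension by dimension.\<close>

definition simplex_weights :: "('a, 'w) wcomplex \<Rightarrow> nat \<Rightarrow> 'w multiset multiset" where
  "simplex_weights K d =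
    image_mset (sweight K) (mset_set {\<sigma> \<in> simplices K. card \<sigma> = d + 1})"

definition Zn :: "int \<Rightarrow> int set" where
  "Zn n = {0..<n}"

definition ic :: "int \<Rightarrow> int \<Rightarrow> int \<Rightarrow> int" where
  "ic n p q = min \<bar>p - q\<bar> (n - \<bar>p - q\<bar>)"

text \<open>Since \<open>ic n\<close> is symmetric, the weight of an edge \<open>{p, q}\<close> may be computed from its
  smaller and its larger element; see \<open>weight_pc_graph\<close> below.\<close>

definition pc_graph :: "int \<Rightarrow> int set \<Rightarrow> (int, int) wgraph" where
  "pc_graph n P =
    \<lparr> verts = P, edges = unordered_pairs P, weight = (\<lambda>e. ic n (Min e) (Max e)) \<rparr>"

lemma weight_pc_graph: "weight (pc_graph n P) {p, q} = ic n p q"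
  by (auto simp: pc_graph_def ic_def min_def max_def)

definition mu :: "int \<Rightarrow> int set \<Rightarrow> int multiset" where
  "mu n P = image_mset (weight (pc_graph n P)) (mset_set (edges (pc_graph n P)))"

definition transposition :: "int \<Rightarrow> int \<Rightarrow> int \<Rightarrow> int" where
  "transposition n s p = (p + s) mod n"

definition inversion :: "int \<Rightarrow> int \<Rightarrow> int \<Rightarrow> int" where
  "inversion n s p = (s - p) mod n"

definition dihedral :: "int \<Rightarrow> (int \<Rightarrow> int) set" where
  "dihedral n = transposition n ` Zn n \<union> inversion n ` Zn n"

definition TI_equivalent :: "int \<Rightarrow> int set \<Rightarrow> int set \<Rightarrow> bool" where
  "TI_equivalent n P Q \<longleftrightarrow> (\<exists>g \<in> dihedral n. Q = g ` P)"

definition Z_related :: "int \<Rightarrow> int set \<Rightarrow> int set \<Rightarrow> bool" where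
  "Z_related n P Q \<longleftrightarrow> mu n P = mu n Q \<and> \<not> TI_equivalent n P Q"

end

theory Submission
  imports Defs
begin

text \<open>
  The \<open>2\<close>-skeleton already determines a pitch class set up to T/I-equivalence. An isomorphism of
  \<open>2\<close>-skeleta is a bijection of pitch classes that preserves interval classes, so modulo \<open>n\<close> it
  preserves each difference up to sign. These signs can be chosen uniformly
  (\<open>interval_class_rigidity\<close>): measuring differences from a base point \<open>a\<close>, if \<open>x = p - a\<close> goes
  to \<open>-x\<close> and \<open>y = q - a\<close> goes to \<open>y\<close>, then \<open>x + y \<equiv> \<plusminus> (x - y)\<close>, so \<open>2 x \<equiv> 0\<close> or
  \<open>2 y \<equiv> 0\<close>, and for such an element the two signs agree. A uniform sign \<open>+\<close> makes the
  bijection a transposition, a uniform sign \<open>-\<close> makes it an inversion.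

  Hence sets that are not T/I-equivalent have non-isomorphic \<open>2\<close>-skeleta, and therefore
  non-isomorphic complexes, because isomorphisms restrict to skeleta
  (\<open>wcomplex_iso_skeleton\<close>). Simplices of the \<open>1\<close>-skeleton are points of empty weight, so
  \<open>k = 2\<close> is a witness when the two sets have equally many elements. Otherwise \<open>k = 1\<close> is
  one: the \<open>1\<close>-skeleta differ in their number of vertices, and the \<open>0\<close>-skeleta are empty.
\<close>

lemma unordered_pairs_singleton: "unordered_pairs {p} = {}"
  by (auto simp: unordered_pairs_def)

lemma unordered_pairs_doubleton: "p \<noteq> q \<Longrightarrow> unordered_pairs {p, q} = {{p, q}}"
  by (auto simp: unordered_pairs_def)

text \<open>An isomorphism is injective on vertices, so it preserves the cardinality of simplices.\<close>

lemma wcomplex_iso_skeleton: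
  assumes "wcomplex_iso K L"
  shows "wcomplex_iso (skeleton k K) (skeleton k L)"
proof -
  obtain f where f: "bij_betw f (vertices K) (vertices L)"
      and F: "bij_betw (image f) (simplices K) (simplices L)"
      and w: "\<forall>\<sigma>\<in>simplices K. sweight L (f ` \<sigma>) = sweight K \<sigma>"
    using assms unfolding wcomplex_iso_def by blast
  have inj: "inj_on f (vertices K)" and injF: "inj_on (image f) (simplices K)"
    using f F by (auto simp: bij_betw_def)
  have card: "card (f ` \<sigma>) = card \<sigma>" if "\<sigma> \<in> simplices K" for \<sigma>
    using that by (intro card_image inj_on_subset[OF inj]) (auto simp: vertices_def)
  have imF: "simplices L = image f ` simplices K"
    using F by (auto simp: bij_betw_def)
  have im: "simplices (skeleton k L) = image f ` simplices (skeleton k K)"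
    unfolding skeleton_def imF by (auto simp: card)
  have "bij_betw (image f) (simplices (skeleton k K)) (simplices (skeleton k L))"
    unfolding bij_betw_def im
    by (auto intro: inj_on_subset[OF injF] simp: skeleton_def)
  moreover have "bij_betw f (vertices (skeleton k K)) (vertices (skeleton k L))"
    unfolding bij_betw_def
  proof
    show "inj_on f (vertices (skeleton k K))"
      by (rule inj_on_subset[OF inj]) (auto simp: vertices_def skeleton_def)
    show "f ` vertices (skeleton k K) = vertices (skeleton k L)"
      unfolding vertices_def im by blast
  qed
  ultimately show ?thesis
    using w unfolding wcomplex_iso_def by (auto simp: skeleton_def)
qed

lemma simplices_skeleton_pc_graph:
  "simplices (skeleton k (clique_complex (pc_graph n P))) =
    {\<sigma>. finite \<sigma> \<and> \<sigma> \<noteq> {} \<and> \<sigma> \<subseteq> P \<and> card \<sigma> \<le> k}"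
  by (auto simp: skeleton_def clique_complex_def is_clique_def pc_graph_def unordered_pairs_def)

lemma vertices_skeleton_pc_graph:
  assumes "k \<ge> 1"
  shows "vertices (skeleton k (clique_complex (pc_graph n P))) = P"
proof
  show "P \<subseteq> vertices (skeleton k (clique_complex (pc_graph n P)))"
  proof
    fix p assume "p \<in> P"
    then have "{p} \<in> simplices (skeleton k (clique_complex (pc_graph n P)))"
      using assms by (simp add: simplices_skeleton_pc_graph)
    then show "p \<in> vertices (skeleton k (clique_complex (pc_graph n P)))"
      unfolding vertices_def by blast
  qed
qed (auto simp: vertices_def simplices_skeleton_pc_graph)

lemma sweight_edge:
  assumes "p \<noteq> q"
  shows "sweight (skeleton k (clique_complex (pc_graph n P))) {p, q} = {#ic n p q#}"
  using assms
  by (simp add: skeleton_def clique_complex_def unordered_pairs_doubleton weight_pc_graph)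

lemma simplex_weights_0_skeleton:
  "simplex_weights (skeleton 0 (clique_complex (pc_graph n P))) d = {#}"
proof -
  have "simplices (skeleton 0 (clique_complex (pc_graph n P))) = {}"
    by (auto simp: simplices_skeleton_pc_graph)
  then show ?thesis
    by (simp add: simplex_weights_def)
qed

lemma simplex_weights_1_skeleton:
  "simplex_weights (skeleton 1 (clique_complex (pc_graph n P))) d =
    (if d = 0 then replicate_mset (card P) {#} else {#})"
proof (cases "d = 0")
  case True
  have "{\<sigma> \<in> simplices (skeleton 1 (clique_complex (pc_graph n P))). card \<sigma> = d + 1} =
      (\<lambda>p. {p}) ` P" (is "?S = _")
    using True by (auto simp: simplices_skeleton_pc_graph card_1_singleton_iff)
  moreover have "card ((\<lambda>p. {p}) ` P) = card P"
    by (simp add: card_image)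
  moreover have "simplex_weights (skeleton 1 (clique_complex (pc_graph n P))) d =
      image_mset (\<lambda>_. {#}) (mset_set ?S)"
    unfolding simplex_weights_def
  proof (rule image_mset_cong)
    fix \<sigma> assume "\<sigma> \<in># mset_set ?S"
    then have "\<sigma> \<in> ?S"
      by (metis elem_mset_set empty_iff mset_set.infinite set_mset_empty)
    then obtain p where "\<sigma> = {p}"
      using True by (auto simp: card_1_singleton_iff)
    then show "sweight (skeleton 1 (clique_complex (pc_graph n P))) \<sigma> = {#}"
      by (simp add: skeleton_def clique_complex_def unordered_pairs_singleton)
  qed
  ultimately show ?thesis
    using True by (simp add: image_mset_const_eq)
next
  case False
  have "{\<sigma> \<in> simplices (skeleton 1 (clique_complex (pc_graph n P))). card \<sigma> = d + 1} = {}"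
    using False by (auto simp: simplices_skeleton_pc_graph)
  then have "simplex_weights (skeleton 1 (clique_complex (pc_graph n P))) d =
      image_mset (sweight (skeleton 1 (clique_complex (pc_graph n P)))) (mset_set {})"
    unfolding simplex_weights_def by (rule arg_cong)
  then show ?thesis
    using False by simp
qed

text \<open>The interval class is the distance on a cycle of length \<open>n\<close>, which determines the
  difference modulo \<open>n\<close> up to sign.\<close>

lemma ic_eq_imp_dvd:
  assumes "ic n p' q' = ic n p q"
  shows "n dvd (p' - q') - (p - q) \<or> n dvd (p' - q') + (p - q)"
proof -
  have "(p' - q') - (p - q) \<in> {0, n, - n} \<or> (p' - q') + (p - q) \<in> {0, n, - n}"
    using assms unfolding ic_def by (auto simp: min_def abs_if split: if_splits)
  then show ?thesis
    by auto
qed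

lemma interval_class_rigidity:
  assumes ic: "\<And>p q. p \<in> P \<Longrightarrow> q \<in> P \<Longrightarrow> ic n (f p) (f q) = ic n p q"
    and "a \<in> P"
  shows "(\<forall>q\<in>P. n dvd (f q - f a) - (q - a)) \<or> (\<forall>q\<in>P. n dvd (f q - f a) + (q - a))"
proof (rule disjCI)
  assume "\<not> (\<forall>q\<in>P. n dvd (f q - f a) + (q - a))"
  then obtain p where p: "p \<in> P" and not_minus: "\<not> n dvd (f p - f a) + (p - a)"
    by blast
  have plus: "n dvd (f p - f a) - (p - a)"
    using ic_eq_imp_dvd[OF ic[OF p \<open>a \<in> P\<close>]] not_minus by blast
  show "\<forall>q\<in>P. n dvd (f q - f a) - (q - a)"
  proof (intro ballI, rule ccontr)
    fix q assume q: "q \<in> P" and not_plus: "\<not> n dvd (f q - f a) - (q - a)"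
    have minus: "n dvd (f q - f a) + (q - a)"
      using ic_eq_imp_dvd[OF ic[OF q \<open>a \<in> P\<close>]] not_plus by blast
    from ic_eq_imp_dvd[OF ic[OF p q]] show False
    proof
      \<comment> \<open>Here \<open>2 (q - a) \<equiv> 0\<close>, so the sign \<open>+\<close> is also correct for \<open>q\<close>.\<close>
      assume "n dvd (f p - f q) - (p - q)"
      from dvd_diff[OF plus this] have "n dvd (f q - f a) - (q - a)"
        by (simp add: algebra_simps)
      with not_plus show False ..
    next
      \<comment> \<open>Here \<open>2 (p - a) \<equiv> 0\<close>, so the sign \<open>-\<close> is also correct for \<open>p\<close>.\<close>
      assume "n dvd (f p - f q) + (p - q)"
      from dvd_add[OF minus this] have "n dvd (f p - f a) + (p - a)"
        by (simp add: algebra_simps)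
      with not_minus show False ..
    qed
  qed
qed

text \<open>The base point \<open>a\<close> fixes the dihedral parameter: \<open>f a - a\<close> for a transposition and
  \<open>f a + a\<close> for an inversion.\<close>

lemma TI_equivalent_if_interval_classes_preserved:
  assumes n: "n > 0" and f: "f ` P \<subseteq> Zn n"
    and ic: "\<And>p q. p \<in> P \<Longrightarrow> q \<in> P \<Longrightarrow> ic n (f p) (f q) = ic n p q"
  shows "TI_equivalent n P (f ` P)"
proof (cases "P = {}")
  case True
  moreover have "transposition n 0 \<in> dihedral n"
    using n by (simp add: dihedral_def Zn_def)
  ultimately show ?thesis
    by (auto simp: TI_equivalent_def)
next
  case False
  then obtain a where a: "a \<in> P"
    by blast
  have range: "f q mod n = f q" if "q \<in> P" for q
    using f that by (auto simp: Zn_def image_subset_iff)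
  consider (plus) "\<forall>q\<in>P. n dvd (f q - f a) - (q - a)"
    | (minus) "\<forall>q\<in>P. n dvd (f q - f a) + (q - a)"
    using interval_class_rigidity[OF ic a] by blast
  then obtain g where "g \<in> dihedral n" and g: "\<forall>q\<in>P. f q = g q"
  proof cases
    case plus
    show ?thesis
    proof
      show "transposition n ((f a - a) mod n) \<in> dihedral n"
        using n by (simp add: dihedral_def Zn_def)
      show "\<forall>q\<in>P. f q = transposition n ((f a - a) mod n) q"
      proof
        fix q assume q: "q \<in> P"
        then have "n dvd f q - (q + (f a - a))"
          using plus by (simp add: algebra_simps)
        then have "f q mod n = (q + (f a - a)) mod n"
          by (simp add: mod_eq_dvd_iff)
        then show "f q = transposition n ((f a - a) mod n) q"
          using range[OF q] by (simp add: transposition_def mod_simps)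
      qed
    qed
  next
    case minus
    show ?thesis
    proof
      show "inversion n ((f a + a) mod n) \<in> dihedral n"
        using n by (simp add: dihedral_def Zn_def)
      show "\<forall>q\<in>P. f q = inversion n ((f a + a) mod n) q"
      proof
        fix q assume q: "q \<in> P"
        then have "n dvd f q - ((f a + a) - q)"
          using minus by (simp add: algebra_simps)
        then have "f q mod n = ((f a + a) - q) mod n"
          by (simp add: mod_eq_dvd_iff)
        then show "f q = inversion n ((f a + a) mod n) q"
          using range[OF q] by (simp add: inversion_def mod_simps)
      qed
    qed
  qed
  moreover from g have "f ` P = g ` P"
    by (intro image_cong) auto
  ultimately show ?thesis
    unfolding TI_equivalent_def by blast
qed

lemma TI_equivalent_if_2_skeleta_iso:
  assumes n: "n > 0" and Q: "Q \<subseteq> Zn n"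
    and iso: "wcomplex_iso (skeleton 2 (clique_complex (pc_graph n P)))
                           (skeleton 2 (clique_complex (pc_graph n Q)))"
      (is "wcomplex_iso ?K ?L")
  shows "TI_equivalent n P Q"
proof -
  obtain f where f: "bij_betw f P Q"
      and w: "\<forall>\<sigma>\<in>simplices ?K. sweight ?L (f ` \<sigma>) = sweight ?K \<sigma>"
    using iso by (auto simp: wcomplex_iso_def vertices_skeleton_pc_graph)
  have im: "f ` P = Q"
    using f by (simp add: bij_betw_def)
  have "ic n (f p) (f q) = ic n p q" if p: "p \<in> P" and q: "q \<in> P" for p q
  proof (cases "p = q")
    case True
    then show ?thesis
      by (simp add: ic_def)
  next
    case False
    then have "f p \<noteq> f q"
      using f p q by (auto simp: bij_betw_def inj_on_def)
    moreover have "{p, q} \<in> simplices ?K"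
      using p q False by (simp add: simplices_skeleton_pc_graph)
    then have "sweight ?L {f p, f q} = sweight ?K {p, q}"
      using w by fastforce
    ultimately show ?thesis
      using False by (simp add: sweight_edge)
  qed
  then show ?thesis
    using TI_equivalent_if_interval_classes_preserved[of n f P] n Q im by blast
qed

theorem theorem2p3:
  fixes n :: int and P1 P2 :: "int set"
  assumes "n > 0"
    and "P1 \<subseteq> Zn n" and "P2 \<subseteq> Zn n"
    and "Z_related n P1 P2"
  shows "\<not> wcomplex_iso (clique_complex (pc_graph n P1)) (clique_complex (pc_graph n P2)) \<and>
    (\<exists>k\<ge>1.
      \<not> wcomplex_iso (skeleton k (clique_complex (pc_graph n P1)))
                     (skeleton k (clique_complex (pc_graph n P2))) \<and>
      simplex_weights (skeleton (k - 1) (clique_complex (pc_graph n P1))) =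
      simplex_weights (skeleton (k - 1) (clique_complex (pc_graph n P2))))"
    (is "\<not> wcomplex_iso ?K ?L \<and> (\<exists>k\<ge>1. ?separates k)")
proof
  have not_iso: "\<not> wcomplex_iso (skeleton 2 ?K) (skeleton 2 ?L)"
    using TI_equivalent_if_2_skeleta_iso assms by (auto simp: Z_related_def)
  then show "\<not> wcomplex_iso ?K ?L"
    using wcomplex_iso_skeleton by blast
  show "\<exists>k\<ge>1. ?separates k"
  proof (cases "card P1 = card P2")
    case True
    then have "simplex_weights (skeleton 1 ?K) = simplex_weights (skeleton 1 ?L)"
      by (intro ext) (simp only: simplex_weights_1_skeleton)
    then have "?separates 2"
      using not_iso by simp
    then show ?thesis
      by (intro exI[of _ 2]) simp
  next
    case False
    have "\<not> wcomplex_iso (skeleton 1 ?K) (skeleton 1 ?L)"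
    proof
      assume "wcomplex_iso (skeleton 1 ?K) (skeleton 1 ?L)"
      then obtain f where "bij_betw f P1 P2"
        unfolding wcomplex_iso_def vertices_skeleton_pc_graph[OF order_refl] by blast
      with False show False
        using bij_betw_same_card by blast
    qed
    moreover have "simplex_weights (skeleton 0 ?K) = simplex_weights (skeleton 0 ?L)"
      by (intro ext) (simp only: simplex_weights_0_skeleton)
    ultimately have "?separates 1"
      by simp
    then show ?thesis
      by (intro exI[of _ 1]) simp
  qed
qed

end
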